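(* For any $\bar w,\bar z\in\{0,1\}^{\mathcal T}$ and any $t\in\mathcal T$, if $(x,y,s)$ is an extreme point of $P(\bar w,\bar z)$, then $s_t\in S^{aux}_t$, where $S^{aux}_t=(A_t\cup B_t)\cap[L^s_t,U^s_t]$ with $A_t=\{K-\sum_{i=1}^t(v^1_iL'^y_i+v^2_iU'^y_i)+\sum_{i=1}^t(u^1_iL'^x_i+u^2_iU'^x_i): K\in\{s_0,U^s_1,\dots,U^s_t,L^s_1,\dots,L^s_t\},\ v^1,v^2,u^1,u^2\in\{0,1\}^t,\ v^1_i+v^2_i+u^1_i+u^2_i\le1\ \forall i\}$ and $B_t=\{K'+\sum_{i=t+1}^T(v^3_iL'^y_i+v^4_iU'^y_i)-\sum_{i=t+1}^T(u^3_iL'^x_i+u^4_iU'^x_i): K'\in\{U^s_{t+1},\dots,U^s_T,L^s_{t+1},\dots,L^s_T\},\ v^3,v^4,u^3,u^4\in\{0,1\}^{\{t+1,\dots,T\}},\ v^3_i+v^4_i+u^3_i+u^4_i\le1\ \forall i\}$.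
   Context: Let $T\ge1$, $\mathcal T=\{1,\dots,T\}$, finite nonnegative reals $L^s_t,U^s_t,L^x_t,U^x_t,L^y_t,U^y_t$ ($t\in\mathcal T$) and a given initial stock $s_0$. For $\bar w,\bar z\in\{0,1\}^{\mathcal T}$ set $(L'^x_t,U'^x_t)=(L^x_t,U^x_t)$ if $\bar w_t=1$ and $(0,0)$ otherwise; $(L'^y_t,U'^y_t)=(L^y_t,U^y_t)$ if $\bar z_t=1$ and $(0,0)$ otherwise. $Q(\bar w,\bar z)$ is the set of $(x,y,s)\in(\mathbb R^{\mathcal T})^3$ such that for all $t$: $s_t=s_{t-1}-y_t+x_t$, $x_ty_t=0$, $L^s_t\le s_t\le U^s_t$, $L'^y_t\le y_t\le U'^y_t$, $L'^x_t\le x_t\le U'^x_t$; $P(\bar w,\bar z)=\mathrm{conv}(Q(\bar w,\bar z))$. *)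

theory Defs
  imports "HOL-Analysis.Analysis" "HOL-Analysis.Finite_Function_Topology"
begin

text \<open>
  Families of data are functions on \<^typ>\<open>nat\<close> of which only the values at the
  periods \<open>1, \<dots>, T\<close> matter. Elements of \<open>\<real>\<^sup>T\<close> are finitely supported functions
  \<^typ>\<open>nat \<Rightarrow>\<^sub>0 real\<close> with support in \<open>{1..T}\<close>: for varying \<open>T\<close> this is a copy of \<open>\<real>\<^sup>T\<close>
  inside one real vector space, in which convex hulls and extreme points are available.
\<close>

definition period_vecs :: "nat \<Rightarrow> (nat \<Rightarrow>\<^sub>0 real) set" where
  "period_vecs T = {x. Poly_Mapping.keys x \<subseteq> {1..T}}"

text \<open>The primed bounds: \<open>L'\<^sup>x = gated w Lx\<close>, \<open>U'\<^sup>y = gated z Uy\<close>, and so on.\<close>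

definition gated :: "(nat \<Rightarrow> nat) \<Rightarrow> (nat \<Rightarrow> real) \<Rightarrow> nat \<Rightarrow> real" where
  "gated w b t = (if w t = 1 then b t else 0)"

text \<open>The stock \<open>s\<^sub>t\<close> including \<open>t = 0\<close>; the initial stock is data, not a coordinate of \<open>s\<close>.\<close>

definition stock :: "real \<Rightarrow> (nat \<Rightarrow>\<^sub>0 real) \<Rightarrow> nat \<Rightarrow> real" where
  "stock s0 s t = (if t = 0 then s0 else Poly_Mapping.lookup s t)"

definition Q_set ::
  "nat \<Rightarrow> real \<Rightarrow> (nat \<Rightarrow> real) \<Rightarrow> (nat \<Rightarrow> real) \<Rightarrow> (nat \<Rightarrow> real) \<Rightarrow> (nat \<Rightarrow> real)
    \<Rightarrow> (nat \<Rightarrow> real) \<Rightarrow> (nat \<Rightarrow> real) \<Rightarrow> (nat \<Rightarrow> nat) \<Rightarrow> (nat \<Rightarrow> nat)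
    \<Rightarrow> ((nat \<Rightarrow>\<^sub>0 real) \<times> (nat \<Rightarrow>\<^sub>0 real) \<times> (nat \<Rightarrow>\<^sub>0 real)) set" where
  "Q_set T s0 Ls Us Lx Ux Ly Uy w z =
    {(x, y, s). x \<in> period_vecs T \<and> y \<in> period_vecs T \<and> s \<in> period_vecs T \<and>
      (\<forall>t\<in>{1..T}.
        stock s0 s t = stock s0 s (t - 1) - Poly_Mapping.lookup y t + Poly_Mapping.lookup x t \<and>
        Poly_Mapping.lookup x t * Poly_Mapping.lookup y t = 0 \<and>
        Ls t \<le> stock s0 s t \<and> stock s0 s t \<le> Us t \<and>
        gated z Ly t \<le> Poly_Mapping.lookup y t \<and> Poly_Mapping.lookup y t \<le> gated z Uy t \<and>
        gated w Lx t \<le> Poly_Mapping.lookup x t \<and> Poly_Mapping.lookup x t \<le> gated w Ux t)}"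

definition P_set ::
  "nat \<Rightarrow> real \<Rightarrow> (nat \<Rightarrow> real) \<Rightarrow> (nat \<Rightarrow> real) \<Rightarrow> (nat \<Rightarrow> real) \<Rightarrow> (nat \<Rightarrow> real)
    \<Rightarrow> (nat \<Rightarrow> real) \<Rightarrow> (nat \<Rightarrow> real) \<Rightarrow> (nat \<Rightarrow> nat) \<Rightarrow> (nat \<Rightarrow> nat)
    \<Rightarrow> ((nat \<Rightarrow>\<^sub>0 real) \<times> (nat \<Rightarrow>\<^sub>0 real) \<times> (nat \<Rightarrow>\<^sub>0 real)) set" where
  "P_set T s0 Ls Us Lx Ux Ly Uy w z = convex hull (Q_set T s0 Ls Us Lx Ux Ly Uy w z)"

definition A_set ::
  "real \<Rightarrow> (nat \<Rightarrow> real) \<Rightarrow> (nat \<Rightarrow> real) \<Rightarrow> (nat \<Rightarrow> real) \<Rightarrow> (nat \<Rightarrow> real)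
    \<Rightarrow> (nat \<Rightarrow> real) \<Rightarrow> (nat \<Rightarrow> real) \<Rightarrow> (nat \<Rightarrow> nat) \<Rightarrow> (nat \<Rightarrow> nat) \<Rightarrow> nat \<Rightarrow> real set" where
  "A_set s0 Ls Us Lx Ux Ly Uy w z t =
    {K - (\<Sum>i=1..t. real (v1 i) * gated z Ly i + real (v2 i) * gated z Uy i)
       + (\<Sum>i=1..t. real (u1 i) * gated w Lx i + real (u2 i) * gated w Ux i) | K v1 v2 u1 u2.
      K \<in> {s0} \<union> Us ` {1..t} \<union> Ls ` {1..t} \<and>
      v1 \<in> {1..t} \<rightarrow> {0, 1} \<and> v2 \<in> {1..t} \<rightarrow> {0, 1} \<and>
      u1 \<in> {1..t} \<rightarrow> {0, 1} \<and> u2 \<in> {1..t} \<rightarrow> {0, 1} \<and>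
      (\<forall>i\<in>{1..t}. v1 i + v2 i + u1 i + u2 i \<le> (1::nat))}"

definition B_set ::
  "nat \<Rightarrow> (nat \<Rightarrow> real) \<Rightarrow> (nat \<Rightarrow> real) \<Rightarrow> (nat \<Rightarrow> real) \<Rightarrow> (nat \<Rightarrow> real)
    \<Rightarrow> (nat \<Rightarrow> real) \<Rightarrow> (nat \<Rightarrow> real) \<Rightarrow> (nat \<Rightarrow> nat) \<Rightarrow> (nat \<Rightarrow> nat) \<Rightarrow> nat \<Rightarrow> real set" where
  "B_set T Ls Us Lx Ux Ly Uy w z t =
    {K + (\<Sum>i=t+1..T. real (v3 i) * gated z Ly i + real (v4 i) * gated z Uy i)
       - (\<Sum>i=t+1..T. real (u3 i) * gated w Lx i + real (u4 i) * gated w Ux i) | K v3 v4 u3 u4.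
      K \<in> Us ` {t+1..T} \<union> Ls ` {t+1..T} \<and>
      v3 \<in> {t+1..T} \<rightarrow> {0, 1} \<and> v4 \<in> {t+1..T} \<rightarrow> {0, 1} \<and>
      u3 \<in> {t+1..T} \<rightarrow> {0, 1} \<and> u4 \<in> {t+1..T} \<rightarrow> {0, 1} \<and>
      (\<forall>i\<in>{t+1..T}. v3 i + v4 i + u3 i + u4 i \<le> (1::nat))}"

definition S_aux ::
  "nat \<Rightarrow> real \<Rightarrow> (nat \<Rightarrow> real) \<Rightarrow> (nat \<Rightarrow> real) \<Rightarrow> (nat \<Rightarrow> real) \<Rightarrow> (nat \<Rightarrow> real)
    \<Rightarrow> (nat \<Rightarrow> real) \<Rightarrow> (nat \<Rightarrow> real) \<Rightarrow> (nat \<Rightarrow> nat) \<Rightarrow> (nat \<Rightarrow> nat) \<Rightarrow> nat \<Rightarrow> real set" where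
  "S_aux T s0 Ls Us Lx Ux Ly Uy w z t =
    (A_set s0 Ls Us Lx Ux Ly Uy w z t \<union> B_set T Ls Us Lx Ux Ly Uy w z t) \<inter> {Ls t..Us t}"

end

theory Submission
  imports Defs
begin

text \<open>
  An extreme point of \<open>P\<close> lies in \<open>Q\<close>. Call a period free if its net inflow \<open>x - y\<close> differs from
  \<open>0\<close> and from all gated bounds. Suppose \<open>s\<^sub>t\<close> is not at a bound. Go back from \<open>t\<close> to the last
  period \<open>a\<close> with stock at a bound (or \<open>a = 0\<close>), and forward to the first such period \<open>b\<close>
  (or \<open>b = T + 1\<close>). If no period in \<open>{a+1..t}\<close> is free, summing the balance equations gives
  \<open>s\<^sub>t \<in> A\<^sub>t\<close>; if \<open>b \<le> T\<close> and no period in \<open>{t+1..b}\<close> is free, then \<open>s\<^sub>t \<in> B\<^sub>t\<close>. Otherwise a small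
  amount of stock can be added or removed between a free period \<open>i \<le> t\<close> and a free period \<open>j > t\<close>
  (or the end of the horizon), so the point is the midpoint of two other points of \<open>Q\<close>.
\<close>

lemma finite_positive_lower_bound:
  fixes f :: "'a \<Rightarrow> real"
  assumes "finite I" and "\<And>i. i \<in> I \<Longrightarrow> 0 < f i"
  shows "\<exists>r>0. \<forall>i\<in>I. r \<le> f i"
proof (intro exI conjI)
  \<comment> \<open>Inserting 1 keeps the minimum defined and positive even if \<open>I\<close> is
    empty.\<close>
  show "0 < Min (insert 1 (f ` I))"
    using assms by simp
  show "\<forall>i\<in>I. Min (insert 1 (f ` I)) \<le> f i"
    using assms(1) by simp
qed

lemma extreme_point_no_perturbation:
  fixes p d :: "'a::real_vector"
  assumes "p extreme_point_of convex hull S" and "p + d \<in> S" and "p - d \<in> S"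
  shows "d = 0"
proof (rule ccontr)
  assume "d \<noteq> 0"
  have "p - d \<noteq> p + d"
  proof
    assume "p - d = p + d"
    then have "2 *\<^sub>R d = 0"
      by (simp add: scaleR_2 algebra_simps)
    with \<open>d \<noteq> 0\<close> show False by simp
  qed
  moreover have "p = (1 - 1/2) *\<^sub>R (p - d) + (1/2) *\<^sub>R (p + d)"
    by (simp add: algebra_simps flip: scaleR_left_distrib)
  ultimately have "p \<in> open_segment (p - d) (p + d)"
    unfolding in_segment by (intro conjI exI[of _ "1/2"]) auto
  moreover have "p - d \<in> convex hull S" "p + d \<in> convex hull S"
    using assms by (auto intro: hull_inc)
  ultimately show False
    using assms(1) unfolding extreme_point_of_def by blast
qed

text \<open>The complement of the free values: a free period is a \<open>k\<close> with
  \<open>x - y\<close> outside this set. Levels of \<open>y\<close> are negated because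
  \<open>y\<close> is an outflow.\<close>

definition net_levels ::
  "(nat \<Rightarrow> real) \<Rightarrow> (nat \<Rightarrow> real) \<Rightarrow> (nat \<Rightarrow> real) \<Rightarrow> (nat \<Rightarrow> real)
    \<Rightarrow> (nat \<Rightarrow> nat) \<Rightarrow> (nat \<Rightarrow> nat) \<Rightarrow> nat \<Rightarrow> real set" where
  "net_levels Lx Ux Ly Uy w z k =
    {0, - gated z Ly k, - gated z Uy k, gated w Lx k, gated w Ux k}"

lemma net_levels_selection:
  assumes "\<And>k. k \<in> I \<Longrightarrow> D k \<in> net_levels Lx Ux Ly Uy w z k"
  obtains v1 v2 u1 u2 :: "nat \<Rightarrow> nat" where
    "v1 \<in> I \<rightarrow> {0, 1}" "v2 \<in> I \<rightarrow> {0, 1}" "u1 \<in> I \<rightarrow> {0, 1}" "u2 \<in> I \<rightarrow> {0, 1}"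
    "\<forall>k\<in>I. v1 k + v2 k + u1 k + u2 k \<le> 1"
    "sum D I = (\<Sum>k\<in>I. real (u1 k) * gated w Lx k + real (u2 k) * gated w Ux k)
      - (\<Sum>k\<in>I. real (v1 k) * gated z Ly k + real (v2 k) * gated z Uy k)"
proof -
  let ?vl = "\<lambda>k. D k = - gated z Ly k" and ?vu = "\<lambda>k. D k = - gated z Uy k"
    and ?ul = "\<lambda>k. D k = gated w Lx k" and ?uu = "\<lambda>k. D k = gated w Ux k"
  \<comment> \<open>Levels may coincide, for instance when both gates are closed. Each indicator
    therefore fires only if all earlier ones fail, so at most one is 1; if none fires,
    \<open>D k\<close> is 0.\<close>
  define v1 :: "nat \<Rightarrow> nat" where "v1 k = (if ?vl k then 1 else 0)" for k
  define v2 :: "nat \<Rightarrow> nat" where "v2 k = (if \<not> ?vl k \<and> ?vu k then 1 else 0)" for k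
  define u1 :: "nat \<Rightarrow> nat"
    where "u1 k = (if \<not> ?vl k \<and> \<not> ?vu k \<and> ?ul k then 1 else 0)" for k
  define u2 :: "nat \<Rightarrow> nat"
    where "u2 k = (if \<not> ?vl k \<and> \<not> ?vu k \<and> \<not> ?ul k \<and> ?uu k then 1 else 0)" for k
  note defs = v1_def v2_def u1_def u2_def
  show thesis
  proof (rule that[of v1 v2 u1 u2])
    show "sum D I = (\<Sum>k\<in>I. real (u1 k) * gated w Lx k + real (u2 k) * gated w Ux k)
      - (\<Sum>k\<in>I. real (v1 k) * gated z Ly k + real (v2 k) * gated z Uy k)"
      unfolding sum_subtractf[symmetric]
    proof (rule sum.cong[OF refl])
      fix k assume "k \<in> I"
      from assms[OF this]
      show "D k = real (u1 k) * gated w Lx k + real (u2 k) * gated w Ux k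
        - (real (v1 k) * gated z Ly k + real (v2 k) * gated z Uy k)"
        unfolding net_levels_def defs by auto
    qed
  qed (auto simp: defs)
qed

text \<open>The sum runs over all of \<open>{1..t}\<close> although the anchor \<open>K\<close> may
  belong to a later period than 0: since 0 is a level, \<open>D\<close> can be padded with zeros up
  to that period.\<close>

lemma A_setI:
  assumes "K \<in> {s0} \<union> Us ` {1..t} \<union> Ls ` {1..t}"
    and "\<And>k. k \<in> {1..t} \<Longrightarrow> D k \<in> net_levels Lx Ux Ly Uy w z k"
  shows "K + sum D {1..t} \<in> A_set s0 Ls Us Lx Ux Ly Uy w z t"
proof -
  obtain v1 v2 u1 u2 :: "nat \<Rightarrow> nat" where
    "v1 \<in> {1..t} \<rightarrow> {0, 1}" "v2 \<in> {1..t} \<rightarrow> {0, 1}"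
    "u1 \<in> {1..t} \<rightarrow> {0, 1}" "u2 \<in> {1..t} \<rightarrow> {0, 1}"
    "\<forall>k\<in>{1..t}. v1 k + v2 k + u1 k + u2 k \<le> 1"
    "sum D {1..t} = (\<Sum>k\<in>{1..t}. real (u1 k) * gated w Lx k + real (u2 k) * gated w Ux k)
      - (\<Sum>k\<in>{1..t}. real (v1 k) * gated z Ly k + real (v2 k) * gated z Uy k)"
    using net_levels_selection[OF assms(2)] by blast
  with assms(1) show ?thesis
    unfolding A_set_def
    by (intro CollectI exI[of _ K] exI[of _ v1] exI[of _ v2] exI[of _ u1] exI[of _ u2]) simp
qed

lemma B_setI:
  assumes "K \<in> Us ` {t+1..T} \<union> Ls ` {t+1..T}"
    and "\<And>k. k \<in> {t+1..T} \<Longrightarrow> D k \<in> net_levels Lx Ux Ly Uy w z k"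
  shows "K - sum D {t+1..T} \<in> B_set T Ls Us Lx Ux Ly Uy w z t"
proof -
  obtain v1 v2 u1 u2 :: "nat \<Rightarrow> nat" where
    "v1 \<in> {t+1..T} \<rightarrow> {0, 1}" "v2 \<in> {t+1..T} \<rightarrow> {0, 1}"
    "u1 \<in> {t+1..T} \<rightarrow> {0, 1}" "u2 \<in> {t+1..T} \<rightarrow> {0, 1}"
    "\<forall>k\<in>{t+1..T}. v1 k + v2 k + u1 k + u2 k \<le> 1"
    "sum D {t+1..T} = (\<Sum>k\<in>{t+1..T}. real (u1 k) * gated w Lx k + real (u2 k) * gated w Ux k)
      - (\<Sum>k\<in>{t+1..T}. real (v1 k) * gated z Ly k + real (v2 k) * gated z Uy k)"
    using net_levels_selection[OF assms(2)] by blast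
  with assms(1) show ?thesis
    unfolding B_set_def
    by (intro CollectI exI[of _ K] exI[of _ v1] exI[of _ v2] exI[of _ u1] exI[of _ u2]) simp
qed

lemma stock_diff_eq_sum:
  assumes "(x, y, s) \<in> Q_set T s0 Ls Us Lx Ux Ly Uy w z" and "a \<le> b" and "b \<le> T"
  shows "stock s0 s b - stock s0 s a =
    (\<Sum>k=a+1..b. Poly_Mapping.lookup x k - Poly_Mapping.lookup y k)"
  using assms(2,3)
proof (induction b rule: dec_induct)
  case base
  then show ?case by simp
next
  case (step n)
  have "\<forall>t\<in>{1..T}. stock s0 s t =
      stock s0 s (t - 1) - Poly_Mapping.lookup y t + Poly_Mapping.lookup x t"
    using assms(1) unfolding Q_set_def by simp
  from bspec[OF this, of "Suc n"] step show ?case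
    by simp
qed

text \<open>Shifting a small amount of stock into or out of the interval \<open>{i..<j}\<close>
  stays feasible in both directions. The value \<open>j = T + 1\<close> stands for the end of the
  horizon, where no flow has to compensate the change at \<open>i\<close>.\<close>

lemma extreme_point_free_pair:
  fixes x y s :: "nat \<Rightarrow>\<^sub>0 real"
  defines "net \<equiv> \<lambda>k. Poly_Mapping.lookup x k - Poly_Mapping.lookup y k"
  assumes ext: "(x, y, s) extreme_point_of P_set T s0 Ls Us Lx Ux Ly Uy w z"
    and ij: "1 \<le> i" "i < j" "j \<le> T + 1"
    and inner: "\<And>k. k \<in> {i..<j} \<Longrightarrow>
      Ls k < Poly_Mapping.lookup s k \<and> Poly_Mapping.lookup s k < Us k"
    and free_i: "net i \<notin> net_levels Lx Ux Ly Uy w z i"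
    and free_j: "j \<le> T \<Longrightarrow> net j \<notin> net_levels Lx Ux Ly Uy w z j"
  shows False
proof -
  let ?Q = "Q_set T s0 Ls Us Lx Ux Ly Uy w z"
  let ?x = "Poly_Mapping.lookup x" and ?y = "Poly_Mapping.lookup y"
    and ?s = "Poly_Mapping.lookup s"
  have Q: "(x, y, s) \<in> ?Q"
    using ext unfolding P_set_def by (rule extreme_point_of_convex_hull)
  then have per: "x \<in> period_vecs T" "y \<in> period_vecs T" "s \<in> period_vecs T"
    and comp: "\<And>k. k \<in> {1..T} \<Longrightarrow> ?x k * ?y k = 0"
    and bal: "\<And>k. k \<in> {1..T} \<Longrightarrow> stock s0 s k = stock s0 s (k - 1) - ?y k + ?x k"
    and sb: "\<And>k. k \<in> {1..T} \<Longrightarrow> Ls k \<le> stock s0 s k \<and> stock s0 s k \<le> Us k"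
    and yb: "\<And>k. k \<in> {1..T} \<Longrightarrow> gated z Ly k \<le> ?y k \<and> ?y k \<le> gated z Uy k"
    and xb: "\<And>k. k \<in> {1..T} \<Longrightarrow> gated w Lx k \<le> ?x k \<and> ?x k \<le> gated w Ux k"
    unfolding Q_set_def mem_Collect_eq case_prod_conv by blast+
  define F where "F = {i, j} \<inter> {1..T}"
  have free: "net k \<notin> net_levels Lx Ux Ly Uy w z k" if "k \<in> F" for k
    using that free_i free_j unfolding F_def by auto
  \<comment> \<open>Since 0 is a level, a free period has nonzero net inflow, and complementarity
    leaves exactly one active flow.\<close>
  have one: "?x k \<noteq> 0 \<and> ?y k = 0 \<or> ?x k = 0 \<and> ?y k \<noteq> 0" if "k \<in> F" for k
    using free[OF that] comp[of k] that unfolding net_def net_levels_def F_def by auto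
  \<comment> \<open>Distance of the active flow to the nearer of its gated bounds.\<close>
  define slack where "slack k = (if ?x k \<noteq> 0
      then min (?x k - gated w Lx k) (gated w Ux k - ?x k)
      else min (?y k - gated z Ly k) (gated z Uy k - ?y k))" for k
  have "0 < slack k" if "k \<in> F" for k
    using free[OF that] one[OF that] xb[of k] yb[of k] that
    unfolding slack_def net_def net_levels_def F_def by auto
  then obtain r1 where r1: "r1 > 0" "\<And>k. k \<in> F \<Longrightarrow> r1 \<le> slack k"
    using finite_positive_lower_bound[of F slack] unfolding F_def by auto
  obtain r2 where r2: "r2 > 0" "\<And>k. k \<in> {i..<j} \<Longrightarrow> r2 \<le> min (?s k - Ls k) (Us k - ?s k)"
    using finite_positive_lower_bound[of "{i..<j}" "\<lambda>k. min (?s k - Ls k) (Us k - ?s k)"] inner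
    by force
  define r where "r = min r1 r2"
  have "r > 0"
    using r1 r2 by (simp add: r_def)
  define vec :: "(nat \<Rightarrow> real) \<Rightarrow> nat \<Rightarrow>\<^sub>0 real"
    where "vec f = Abs_poly_mapping (\<lambda>k. if k \<in> {1..T} then f k else 0)" for f
  have vec: "Poly_Mapping.lookup (vec f) k = (if k \<in> {1..T} then f k else 0)" for f k
  proof -
    have "finite {k. (if k \<in> {1..T} then f k else 0) \<noteq> 0}"
      by (rule finite_subset[of _ "{1..T}"]) auto
    then show ?thesis
      unfolding vec_def by simp
  qed
  \<comment> \<open>Prescribed change of net inflow. Only a nonzero flow absorbs it, with opposite
    sign for \<open>y\<close>, so products \<open>x * y\<close> stay 0.\<close>
  define e where "e c k = (if k = i then c else if k = j then - c else 0)" for c :: real and k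
  define dx where "dx c = vec (\<lambda>k. if ?x k \<noteq> 0 then e c k else 0)" for c
  define dy where "dy c = vec (\<lambda>k. if ?y k \<noteq> 0 then - e c k else 0)" for c
  define ds where "ds c = vec (\<lambda>k. if k \<in> {i..<j} then c else 0)" for c
  have mem: "(x + dx c, y + dy c, s + ds c) \<in> ?Q" if c: "\<bar>c\<bar> \<le> r" for c
  proof -
    \<comment> \<open>This includes \<open>k = 0\<close>: the initial stock is unchanged, as
      \<open>i\<close> is at least 1.\<close>
    have stock': "stock s0 (s + ds c) k = stock s0 s k + (if k \<in> {i..<j} then c else 0)"
      if "k \<le> T" for k
      using that ij unfolding stock_def ds_def by (auto simp: lookup_add vec)
    have lx: "Poly_Mapping.lookup (x + dx c) k = ?x k + (if ?x k \<noteq> 0 then e c k else 0)"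
      and ly: "Poly_Mapping.lookup (y + dy c) k = ?y k - (if ?y k \<noteq> 0 then e c k else 0)"
      if "k \<in> {1..T}" for k
      using that unfolding dx_def dy_def by (auto simp: lookup_add vec)
    have "x + dx c \<in> period_vecs T" "y + dy c \<in> period_vecs T" "s + ds c \<in> period_vecs T"
      using per unfolding period_vecs_def dx_def dy_def ds_def subset_iff
      by (auto simp: in_keys_iff lookup_add vec)
    moreover have "stock s0 (s + ds c) k = stock s0 (s + ds c) (k - 1)
        - Poly_Mapping.lookup (y + dy c) k + Poly_Mapping.lookup (x + dx c) k"
      if k: "k \<in> {1..T}" for k
    proof -
      \<comment> \<open>The stock change is \<open>c\<close> times the indicator of
        \<open>{i..<j}\<close>, and \<open>e c\<close> is its discrete derivative.\<close>
      have "(if k \<in> {i..<j} then c else 0) = (if k - 1 \<in> {i..<j} then c else 0) + e c k"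
        using k ij unfolding e_def by auto
      moreover have "(if ?x k \<noteq> 0 then e c k else 0) + (if ?y k \<noteq> 0 then e c k else 0) = e c k"
      proof (cases "k \<in> F")
        case True
        then show ?thesis using one by auto
      next
        case False
        then have "e c k = 0" using k unfolding F_def e_def by auto
        then show ?thesis by simp
      qed
      moreover have "k \<le> T" "k - 1 \<le> T"
        using k by auto
      ultimately show ?thesis
        using bal[OF k] unfolding lx[OF k] ly[OF k] by (simp only: stock')
    qed
    moreover have "Poly_Mapping.lookup (x + dx c) k * Poly_Mapping.lookup (y + dy c) k = 0"
      if k: "k \<in> {1..T}" for k
      using comp[OF k] unfolding lx[OF k] ly[OF k] by auto
    moreover have "Ls k \<le> stock s0 (s + ds c) k \<and> stock s0 (s + ds c) k \<le> Us k"
      if k: "k \<in> {1..T}" for k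
    proof (cases "k \<in> {i..<j}")
      case True
      then have "stock s0 s k = ?s k"
        using ij by (simp add: stock_def)
      then show ?thesis
        using r2(2)[OF True] c True stock'[of k] k unfolding r_def by auto
    next
      case False
      then show ?thesis
        using sb[OF k] stock'[of k] k by auto
    qed
    moreover have "gated z Ly k \<le> Poly_Mapping.lookup (y + dy c) k \<and>
        Poly_Mapping.lookup (y + dy c) k \<le> gated z Uy k \<and>
        gated w Lx k \<le> Poly_Mapping.lookup (x + dx c) k \<and>
        Poly_Mapping.lookup (x + dx c) k \<le> gated w Ux k"
      if k: "k \<in> {1..T}" for k
    proof (cases "k \<in> F")
      case True
      have "\<bar>e c k\<bar> \<le> slack k"
        using r1(2)[OF True] c True \<open>r > 0\<close> unfolding e_def r_def F_def by auto
      then show ?thesis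
        using one[OF True] xb[OF k] yb[OF k] unfolding lx[OF k] ly[OF k] slack_def by auto
    next
      case False
      then have "e c k = 0" using k unfolding F_def e_def by auto
      then show ?thesis
        using xb[OF k] yb[OF k] unfolding lx[OF k] ly[OF k] by simp
    qed
    ultimately show ?thesis
      unfolding Q_set_def mem_Collect_eq case_prod_conv by blast
  qed
  have neg: "dx (- r) = - dx r" "dy (- r) = - dy r" "ds (- r) = - ds r"
    by (rule poly_mapping_eqI; simp add: dx_def dy_def ds_def vec e_def)+
  have "(dx r, dy r, ds r) = 0"
  proof (rule extreme_point_no_perturbation)
    show "(x, y, s) extreme_point_of convex hull ?Q"
      using ext unfolding P_set_def .
    show "(x, y, s) + (dx r, dy r, ds r) \<in> ?Q"
      using mem[of r] \<open>r > 0\<close> by simp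
    show "(x, y, s) - (dx r, dy r, ds r) \<in> ?Q"
      using mem[of "- r"] \<open>r > 0\<close> by (simp add: neg)
  qed
  \<comment> \<open>But this entry is \<open>r\<close>, because \<open>i\<close> lies in
    \<open>{i..<j}\<close> and is at most \<open>T\<close>.\<close>
  then have "Poly_Mapping.lookup (ds r) i = 0"
    by (simp add: zero_prod_def)
  then show False
    using ij \<open>r > 0\<close> by (simp add: ds_def vec)
qed

theorem theorem2:
  fixes T :: nat and s0 :: real
    and Ls Us Lx Ux Ly Uy :: "nat \<Rightarrow> real"
    and w z :: "nat \<Rightarrow> nat"
    and x y s :: "nat \<Rightarrow>\<^sub>0 real"
    and t :: nat
  assumes "T \<ge> 1"
    and "\<forall>i\<in>{1..T}. 0 \<le> Ls i \<and> 0 \<le> Us i \<and> 0 \<le> Lx i \<and> 0 \<le> Ux i \<and> 0 \<le> Ly i \<and> 0 \<le> Uy i"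
    and "w \<in> {1..T} \<rightarrow> {0, 1}" and "z \<in> {1..T} \<rightarrow> {0, 1}"
    and "t \<in> {1..T}"
    and "(x, y, s) extreme_point_of P_set T s0 Ls Us Lx Ux Ly Uy w z"
  shows "Poly_Mapping.lookup s t \<in> S_aux T s0 Ls Us Lx Ux Ly Uy w z t"
proof -
  let ?s = "Poly_Mapping.lookup s"
  let ?net = "\<lambda>k. Poly_Mapping.lookup x k - Poly_Mapping.lookup y k"
  let ?N = "net_levels Lx Ux Ly Uy w z"
  have Q: "(x, y, s) \<in> Q_set T s0 Ls Us Lx Ux Ly Uy w z"
    using assms(6) unfolding P_set_def by (rule extreme_point_of_convex_hull)
  have st: "stock s0 s k = ?s k" if "k \<ge> 1" for k
    using that by (simp add: stock_def)
  have sb: "Ls k \<le> ?s k \<and> ?s k \<le> Us k" if "k \<in> {1..T}" for k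
  proof -
    have "Ls k \<le> stock s0 s k \<and> stock s0 s k \<le> Us k"
      using Q that unfolding Q_set_def mem_Collect_eq case_prod_conv by blast
    with that st[of k] show ?thesis by auto
  qed
  have tT: "1 \<le> t" "t \<le> T"
    using assms(5) by auto
  define tight where "tight k \<longleftrightarrow> ?s k = Ls k \<or> ?s k = Us k" for k
  have inner: "Ls k < ?s k \<and> ?s k < Us k" if "k \<in> {1..T}" "\<not> tight k" for k
    using sb[OF that(1)] that(2) unfolding tight_def by auto
  have "?s t \<in> A_set s0 Ls Us Lx Ux Ly Uy w z t \<union> B_set T Ls Us Lx Ux Ly Uy w z t"
  proof (rule ccontr)
    assume neg: "\<not> ?thesis"
    define a where "a = Max {k \<in> {0..t}. k = 0 \<or> tight k}"
    have "a \<in> {k \<in> {0..t}. k = 0 \<or> tight k}"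
      unfolding a_def by (rule Max_in) auto
    then have a: "a \<le> t" "a = 0 \<or> tight a"
      by auto
    have a_last: "\<not> tight k" if "k \<in> {a<..t}" for k
      using that Max_ge[of "{k \<in> {0..t}. k = 0 \<or> tight k}" k] unfolding a_def[symmetric] by auto
    have "\<exists>i\<in>{a<..t}. ?net i \<notin> ?N i"
    proof (rule ccontr)
      assume all: "\<not> ?thesis"
      \<comment> \<open>Zero padding before the anchor period \<open>a\<close>, whose stock serves
        as \<open>K\<close>.\<close>
      define D where "D k = (if k \<in> {a+1..t} then ?net k else 0)" for k
      have "sum D {1..t} = sum ?net {a+1..t}"
        unfolding D_def by (rule sum.mono_neutral_cong_right) auto
      also have "\<dots> = ?s t - stock s0 s a"
        using stock_diff_eq_sum[OF Q a(1) tT(2)] st[OF tT(1)] by simp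
      finally have eq: "stock s0 s a + sum D {1..t} = ?s t"
        by simp
      have "stock s0 s a \<in> {s0} \<union> Us ` {1..t} \<union> Ls ` {1..t}"
        using a by (auto simp: stock_def tight_def)
      moreover have "D k \<in> ?N k" for k
        using all by (auto simp: D_def net_levels_def)
      ultimately have "?s t \<in> A_set s0 Ls Us Lx Ux Ly Uy w z t"
        unfolding eq[symmetric] by (rule A_setI)
      with neg show False by blast
    qed
    then obtain i where i: "i \<in> {a<..t}" "?net i \<notin> ?N i"
      by blast
    define b where "b = Min {k \<in> {t+1..T+1}. k = T + 1 \<or> tight k}"
    have "b \<in> {k \<in> {t+1..T+1}. k = T + 1 \<or> tight k}"
      unfolding b_def using tT by (intro Min_in) auto
    then have b: "t < b" "b \<le> T + 1" "b = T + 1 \<or> tight b"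
      by auto
    have b_first: "\<not> tight k" if "k \<in> {t<..<b}" for k
      using that b(2) Min_le[of "{k \<in> {t+1..T+1}. k = T + 1 \<or> tight k}" k]
      unfolding b_def[symmetric] by auto
    \<comment> \<open>The index \<open>T + 1\<close> satisfies the implication vacuously, so a
      failure forces \<open>b\<close> to be a genuine tight period, whose stock can anchor an
      element of \<open>B_set\<close>.\<close>
    have "\<exists>j\<in>{t<..b}. j \<le> T \<longrightarrow> ?net j \<notin> ?N j"
    proof (rule ccontr)
      assume all: "\<not> ?thesis"
      then have "b \<le> T"
        using b by auto
      then have "tight b"
        using b by auto
      define D where "D k = (if k \<in> {t+1..b} then ?net k else 0)" for k
      have "sum D {t+1..T} = sum ?net {t+1..b}"
        unfolding D_def using \<open>b \<le> T\<close> by (intro sum.mono_neutral_cong_right) auto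
      also have "\<dots> = ?s b - ?s t"
        using stock_diff_eq_sum[OF Q _ \<open>b \<le> T\<close>, of t] st[of t] st[of b] tT b by simp
      finally have eq: "?s b - sum D {t+1..T} = ?s t"
        by simp
      have "?s b \<in> Us ` {t+1..T} \<union> Ls ` {t+1..T}"
        using b \<open>b \<le> T\<close> \<open>tight b\<close> by (auto simp: tight_def)
      moreover have "D k \<in> ?N k" for k
        using all by (auto simp: D_def net_levels_def)
      ultimately have "?s t \<in> B_set T Ls Us Lx Ux Ly Uy w z t"
        unfolding eq[symmetric] by (rule B_setI)
      with neg show False by blast
    qed
    then obtain j where j: "j \<in> {t<..b}" "j \<le> T \<Longrightarrow> ?net j \<notin> ?N j"
      by blast
    have "\<not> tight t"
      using a_last[of t] i(1) by auto
    \<comment> \<open>The interval lies strictly between \<open>a\<close> and \<open>b\<close>: its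
      part up to \<open>t\<close> is covered by \<open>a_last\<close>, the rest by
      \<open>b_first\<close>.\<close>
    then have "\<not> tight k" if "k \<in> {i..<j}" for k
      using that i(1) j(1) a_last[of k] b_first[of k] by (cases k t rule: linorder_cases) auto
    then have "Ls k < ?s k \<and> ?s k < Us k" if "k \<in> {i..<j}" for k
      using that i(1) j(1) b(2) by (intro inner) auto
    then show False
      using extreme_point_free_pair[OF assms(6), of i j] i j b(2) by auto
  qed
  then show ?thesis
    using sb[OF assms(5)] unfolding S_aux_def by auto
qed

end
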